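(* Let $A=\begin{bmatrix} d_1 & b\\ c & d_2\end{bmatrix}\in\mathbb{R}^{2\times 2}$ be a nonnegative matrix having singular values $\sigma_1\ge\sigma_2$ and principal diagonal entries $d_1\ge d_2$. (i) If $bc-d_1d_2\le 0$, then $\sigma_1+\sigma_2\ge d_1+d_2$ and $\sigma_1-\sigma_2\ge d_1-d_2$. (ii) If $bc-d_1d_2>0$, then $\sigma_1-\sigma_2\ge d_1+d_2$. Moreover, in case (i), equality $\sigma_1+\sigma_2=d_1+d_2$ holds if and only if $A$ is symmetric, and equality $\sigma_1-\sigma_2=d_1-d_2$ holds if and only if $A$ is diagonal; in case (ii), equality $\sigma_1-\sigma_2=d_1+d_2$ holds if and only if $A$ is symmetric.
   Context: A nonnegative matrix is a real matrix all of whose entries are $\ge 0$. The singular values of a real matrix $A$ are the nonnegative square roots of the eigenvalues of $A^\top A$, counted with multiplicity. *)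

theory Defs
  imports "Jordan_Normal_Form.Char_Poly" "HOL-Computational_Algebra.Computational_Algebra"
begin

definition nonneg_mat :: "real mat \<Rightarrow> bool" where
  "nonneg_mat A \<longleftrightarrow> (\<forall>i<dim_row A. \<forall>j<dim_col A. A $$ (i, j) \<ge> 0)"

definition symmetric_mat :: "'a mat \<Rightarrow> bool" where
  "symmetric_mat A \<longleftrightarrow> transpose_mat A = A"

(* The multiset proots (char_poly M) contains each eigenvalue of M with its algebraic
   multiplicity.  Only real roots are counted here, which loses nothing: transpose_mat A * A
   is symmetric and positive semidefinite, so all its complex eigenvalues are real and \<ge> 0
   (and its algebraic and geometric multiplicities agree). *)
definition singular_values :: "real mat \<Rightarrow> real multiset" where
  "singular_values A = image_mset sqrt (proots (char_poly (transpose_mat A * A)))"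

end

theory Submission
  imports Defs
begin

text \<open>The trace and determinant of \<open>A\<^sup>T A\<close> give \<open>\<sigma>\<^sub>1\<^sup>2 + \<sigma>\<^sub>2\<^sup>2 = d\<^sub>1\<^sup>2 + d\<^sub>2\<^sup>2 + b\<^sup>2 + c\<^sup>2\<close> and
  \<open>\<sigma>\<^sub>1 \<sigma>\<^sub>2 = \<bar>d\<^sub>1 d\<^sub>2 - b c\<bar>\<close>. Hence, depending on the sign of the determinant,
  \<open>(\<sigma>\<^sub>1 \<plusminus> \<sigma>\<^sub>2)\<^sup>2\<close> is \<open>(d\<^sub>1 + d\<^sub>2)\<^sup>2 + (b - c)\<^sup>2\<close> or \<open>(d\<^sub>1 - d\<^sub>2)\<^sup>2 + (b + c)\<^sup>2\<close>.\<close>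

text \<open>Each listed root splits off a linear factor; by degree the remaining cofactor is a
  constant, and monicity makes it 1. Serves to read off Vieta's formulas from a multiset of
  roots.\<close>

lemma proots_size_2_decomp:
  fixes p :: "'a :: idom poly"
  assumes "monic p" "degree p = 2" "proots p = {#x, y#}"
  shows "p = [:x * y, - (x + y), 1:]"
proof -
  have nz: "p \<noteq> 0" using assms by auto
  have x: "poly p x = 0"
    using set_count_proots[OF nz] assms(3) by auto
  then obtain q where q: "p = [:-x, 1:] * q" by (metis poly_eq_0_iff_dvd dvdE)
  have q0: "q \<noteq> 0" using nz q by auto
  \<comment> \<open>Cancelling in multisets respects multiplicity, so \<open>y\<close> is a root of
    \<open>q\<close> even when \<open>x = y\<close>.\<close>
  have "proots p = {#x#} + proots q"
    using q0 unfolding q by (subst proots_mult) auto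
  then have "proots q = {#y#}" using assms(3) by simp
  then have "poly q y = 0"
    using set_count_proots[OF q0] by auto
  then obtain r where r: "q = [:-y, 1:] * r" by (metis poly_eq_0_iff_dvd dvdE)
  have r0: "r \<noteq> 0" using q0 r by auto
  have "degree p = 2 + degree r"
    using r0 unfolding q r by (simp add: degree_mult_eq del: mult_pCons_left)
  then obtain a where a: "r = [:a:]"
    using assms(2) by (metis add_cancel_left_right degree_eq_zeroE)
  have "a = 1" using assms(1) r0 unfolding q r a by (simp split: if_splits)
  then show ?thesis unfolding q r a by (simp add: algebra_simps)
qed

lemma det_carrier_mat_2:
  fixes M :: "'a :: comm_ring_1 mat"
  assumes "M \<in> carrier_mat 2 2"
  shows "det M = M $$ (0, 0) * M $$ (1, 1) - M $$ (0, 1) * M $$ (1, 0)"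
proof -
  have "mat_delete M i 0 \<in> carrier_mat 1 1" for i
    using mat_delete_carrier[OF assms, of i 0] by simp
  then have "det (mat_delete M i 0) = mat_delete M i 0 $$ (0, 0)" for i
    by (rule det_single)
  moreover have "mat_delete M 0 0 $$ (0, 0) = M $$ (1, 1)"
    "mat_delete M 1 0 $$ (0, 0) = M $$ (0, 1)"
    using assms by (simp_all add: mat_delete_def)
  moreover have "det M = (\<Sum>i<2. M $$ (i, 0) * cofactor M i 0)"
    by (rule laplace_expansion_column[OF assms]) simp
  ultimately show ?thesis
    by (simp add: cofactor_def numeral_2_eq_2 algebra_simps)
qed

lemma char_poly_gram_2:
  fixes a b c d :: "'a :: comm_ring_1"
  defines "A \<equiv> mat_of_rows_list 2 [[a, b], [c, d]]"
  shows "char_poly (transpose_mat A * A)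
    = [:(a * d - b * c)\<^sup>2, - (a\<^sup>2 + b\<^sup>2 + c\<^sup>2 + d\<^sup>2), 1:]"
proof -
  have G: "transpose_mat A * A = mat_of_rows_list 2
      [[a\<^sup>2 + c\<^sup>2, a * b + c * d], [a * b + c * d, b\<^sup>2 + d\<^sup>2]]" (is "_ = ?G")
    by (rule eq_matI)
      (auto simp: A_def mat_of_rows_list_def scalar_prod_def less_Suc_eq numeral_2_eq_2
         power2_eq_square algebra_simps)
  have C: "char_poly_matrix ?G \<in> carrier_mat 2 2"
    by (rule char_poly_matrix_closed, rule carrier_matI) (simp_all add: mat_of_rows_list_def)
  have "char_poly ?G = [:-(a\<^sup>2 + c\<^sup>2), 1:] * [:-(b\<^sup>2 + d\<^sup>2), 1:]
      - [:a * b + c * d:] * [:a * b + c * d:]"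
    unfolding char_poly_def det_carrier_mat_2[OF C]
    by (simp add: char_poly_matrix_def mat_of_rows_list_def algebra_simps)
  \<comment> \<open>The constant coefficient is Lagrange's identity: \<open>(a^2 + c^2) * (b^2 +
    d^2) - (a * b + c * d)^2 = (a * d - b * c)^2\<close>.\<close>
  then show ?thesis
    unfolding G by (simp add: power2_eq_square algebra_simps)
qed

text \<open>Vieta's formulas for the eigenvalues \<open>x\<close>, \<open>y\<close> of the Gram
  matrix, carried over to their square roots.\<close>

lemma singular_values_2:
  fixes a b c d s t :: real
  assumes "singular_values (mat_of_rows_list 2 [[a, b], [c, d]]) = {#s, t#}"
  shows "0 \<le> s" "0 \<le> t" "s\<^sup>2 + t\<^sup>2 = a\<^sup>2 + b\<^sup>2 + c\<^sup>2 + d\<^sup>2" "s * t = \<bar>a * d - b * c\<bar>"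
proof -
  let ?p = "[:(a * d - b * c)\<^sup>2, - (a\<^sup>2 + b\<^sup>2 + c\<^sup>2 + d\<^sup>2), 1:]"
  have "image_mset sqrt (proots ?p) = {#s, t#}"
    using assms unfolding singular_values_def char_poly_gram_2 .
  then obtain x y where xy: "proots ?p = {#x, y#}" "sqrt x = s" "sqrt y = t"
    by (auto dest!: msed_map_invR)
  have "?p = [:x * y, - (x + y), 1:]"
    using xy(1) by (intro proots_size_2_decomp) auto
  then have prod: "x * y = (a * d - b * c)\<^sup>2" and sum: "x + y = a\<^sup>2 + b\<^sup>2 + c\<^sup>2 + d\<^sup>2"
    by (auto simp: algebra_simps)
  \<comment> \<open>Nonnegative sum and product force nonnegative eigenvalues. This matters because
    \<open>sqrt\<close> is an odd function on the reals, so \<open>(sqrt x)^2\<close> is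
    \<open>x\<close> only for \<open>x\<close> \<ge> 0.\<close>
  have "0 \<le> x * y" "0 \<le> x + y" unfolding prod sum by simp_all
  then have nn: "0 \<le> x" "0 \<le> y" by (auto simp: zero_le_mult_iff)
  show "0 \<le> s" "0 \<le> t" using xy nn by auto
  show "s\<^sup>2 + t\<^sup>2 = a\<^sup>2 + b\<^sup>2 + c\<^sup>2 + d\<^sup>2" using xy nn sum by auto
  show "s * t = \<bar>a * d - b * c\<bar>"
    using xy(2,3) prod by (metis real_sqrt_abs real_sqrt_mult)
qed

text \<open>Used with \<open>w\<close> equal to \<open>b - c\<close> or \<open>b + c\<close>, whose
  vanishing expresses the equality case.\<close>

lemma dominates_if_power2_eq_add_power2:
  fixes u v w :: real
  assumes "u\<^sup>2 = v\<^sup>2 + w\<^sup>2" "0 \<le> u" "0 \<le> v"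
  shows "v \<le> u" "u = v \<longleftrightarrow> w = 0"
proof -
  show "v \<le> u" using assms by (intro power2_le_imp_le[of v u]) auto
  show "u = v \<longleftrightarrow> w = 0" using assms by (auto simp: power2_eq_iff_nonneg)
qed

theorem lemma2p2:
  fixes A :: "real mat" and d\<^sub>1 d\<^sub>2 b c \<sigma>\<^sub>1 \<sigma>\<^sub>2 :: real
  assumes A: "A = mat_of_rows_list 2 [[d\<^sub>1, b], [c, d\<^sub>2]]"
    and nonneg: "nonneg_mat A"
    and sv: "singular_values A = {#\<sigma>\<^sub>1, \<sigma>\<^sub>2#}" "\<sigma>\<^sub>1 \<ge> \<sigma>\<^sub>2"
    and d: "d\<^sub>1 \<ge> d\<^sub>2"
  shows "(b * c - d\<^sub>1 * d\<^sub>2 \<le> 0 \<longrightarrow>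
            \<sigma>\<^sub>1 + \<sigma>\<^sub>2 \<ge> d\<^sub>1 + d\<^sub>2 \<and> \<sigma>\<^sub>1 - \<sigma>\<^sub>2 \<ge> d\<^sub>1 - d\<^sub>2 \<and>
            (\<sigma>\<^sub>1 + \<sigma>\<^sub>2 = d\<^sub>1 + d\<^sub>2 \<longleftrightarrow> symmetric_mat A) \<and>
            (\<sigma>\<^sub>1 - \<sigma>\<^sub>2 = d\<^sub>1 - d\<^sub>2 \<longleftrightarrow> diagonal_mat A)) \<and>
         (b * c - d\<^sub>1 * d\<^sub>2 > 0 \<longrightarrow>
            \<sigma>\<^sub>1 - \<sigma>\<^sub>2 \<ge> d\<^sub>1 + d\<^sub>2 \<and>
            (\<sigma>\<^sub>1 - \<sigma>\<^sub>2 = d\<^sub>1 + d\<^sub>2 \<longleftrightarrow> symmetric_mat A))"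
proof -
  note s = singular_values_2[OF sv(1)[unfolded A]]
  have n: "0 \<le> d\<^sub>1" "0 \<le> b" "0 \<le> c" "0 \<le> d\<^sub>2"
    using nonneg unfolding A nonneg_mat_def
    by (auto simp: mat_of_rows_list_def less_Suc_eq numeral_2_eq_2 all_conj_distrib)
  have sym: "symmetric_mat A \<longleftrightarrow> b - c = 0"
    unfolding A symmetric_mat_def mat_eq_iff
    by (auto simp: mat_of_rows_list_def less_Suc_eq numeral_2_eq_2)
  \<comment> \<open>Nonnegative \<open>b\<close> and \<open>c\<close> with sum 0 must both
    vanish.\<close>
  have diag: "diagonal_mat A \<longleftrightarrow> b + c = 0"
    using n unfolding A diagonal_mat_def
    by (auto simp: mat_of_rows_list_def less_Suc_eq numeral_2_eq_2)
  show ?thesis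
  proof (intro conjI impI)
    assume "b * c - d\<^sub>1 * d\<^sub>2 \<le> 0"
    then have *: "\<sigma>\<^sub>1 * \<sigma>\<^sub>2 = d\<^sub>1 * d\<^sub>2 - b * c" using s by simp
    have "(\<sigma>\<^sub>1 + \<sigma>\<^sub>2)\<^sup>2 = (d\<^sub>1 + d\<^sub>2)\<^sup>2 + (b - c)\<^sup>2"
      using s(3) * by (simp add: power2_sum power2_diff)
    from dominates_if_power2_eq_add_power2[OF this]
    show "\<sigma>\<^sub>1 + \<sigma>\<^sub>2 \<ge> d\<^sub>1 + d\<^sub>2" "\<sigma>\<^sub>1 + \<sigma>\<^sub>2 = d\<^sub>1 + d\<^sub>2 \<longleftrightarrow> symmetric_mat A"
      using s(1,2) n sym by auto
    have "(\<sigma>\<^sub>1 - \<sigma>\<^sub>2)\<^sup>2 = (d\<^sub>1 - d\<^sub>2)\<^sup>2 + (b + c)\<^sup>2"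
      using s(3) * by (simp add: power2_sum power2_diff)
    from dominates_if_power2_eq_add_power2[OF this]
    show "\<sigma>\<^sub>1 - \<sigma>\<^sub>2 \<ge> d\<^sub>1 - d\<^sub>2" "\<sigma>\<^sub>1 - \<sigma>\<^sub>2 = d\<^sub>1 - d\<^sub>2 \<longleftrightarrow> diagonal_mat A"
      using sv(2) d diag by auto
  next
    assume "b * c - d\<^sub>1 * d\<^sub>2 > 0"
    \<comment> \<open>The determinant is now negative, which flips the sign of the product.
      Subtracting twice this product adds \<open>2 * d\<^sub>1 * d\<^sub>2\<close> and subtracts
      \<open>2 * b * c\<close>, so the difference of the singular values is now the one compared
      with \<open>d\<^sub>1 + d\<^sub>2\<close>.\<close>
    then have *: "\<sigma>\<^sub>1 * \<sigma>\<^sub>2 = b * c - d\<^sub>1 * d\<^sub>2" using s by simp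
    have "(\<sigma>\<^sub>1 - \<sigma>\<^sub>2)\<^sup>2 = (d\<^sub>1 + d\<^sub>2)\<^sup>2 + (b - c)\<^sup>2"
      using s(3) * by (simp add: power2_sum power2_diff)
    from dominates_if_power2_eq_add_power2[OF this]
    show "\<sigma>\<^sub>1 - \<sigma>\<^sub>2 \<ge> d\<^sub>1 + d\<^sub>2" "\<sigma>\<^sub>1 - \<sigma>\<^sub>2 = d\<^sub>1 + d\<^sub>2 \<longleftrightarrow> symmetric_mat A"
      using sv(2) n sym by auto
  qed
qed

end
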